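(* Let $H$ be a finite simple $k$-uniform hypergraph with $k\ge 2$ and $m=|E(H)|\ge 1$, and let $W\colon[0,1]^{\mathcal{A}_k}\to[0,1]$ be an $S_k$-invariant $k$-uniform hypergraphon. Suppose $a\le W\le 1$ almost everywhere for some $a\in(0,1]$, and put $M:=\log(1/a)$. Then $$\Big\|\log W-\int\log W\Big\|_2^2\le\frac1m\left(2e^{mM}+m^2M^2\right)M\,\Delta_H(W).$$ Consequently, if $p:=\exp\big(\int\log W\big)$, then $$\max\left\{\|W-p\|_2^2,\ \|W-p\|_1^2\right\}\le\frac1m\left(2e^{mM}+m^2M^2\right)M\,\Delta_H(W).$$
   Context: Let $\mathcal{A}_k:=\{A:\emptyset\ne A\subsetneq[k]\}$. A $k$-uniform hypergraphon is a measurable function $W\colon[0,1]^{\mathcal{A}_k}\to[0,1]$ that is $S_k$-invariant: for $\pi\in S_k$ and $\mathbf{x}=(x_A)_{A\in\mathcal{A}_k}$ put $(\pi\cdot\mathbf{x})_A:=x_{\pi^{-1}A}$; then $W(\pi\cdot\mathbf{x})=W(\mathbf{x})$ for every $\pi\in S_k$ and almost every $\mathbf{x}$. Integrals $\int\log W$ and norms $\|\cdot\|_1,\|\cdot\|_2$ are over $[0,1]^{\mathcal{A}_k}$ with Lebesgue measure. Let $H=(V,E)$ be a finite simple $k$-uniform hypergraph ($E$ a set of $k$-element subsets of the finite set $V$). Let $X_B$ be independent uniform $[0,1]$ random variables, one for each nonempty $B\subseteq V$ with $|B|<k$. For each edge $e\in E$ choose a bijection $\eta_e\colon[k]\to e$,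 write $\eta_e(A)=\{\eta_e(i):i\in A\}$ and $X_e^\circ:=(X_{\eta_e(A)})_{A\in\mathcal{A}_k}$ (by invariance the choice of orderings is immaterial). Define $t(H,W):=\mathbb{E}\prod_{e\in E}W(X_e^\circ)$ and, for $e\in E$, the full-edge-rooted density $$r_e^W(\mathbf{x}):=\mathbb{E}\Big[\prod_{f\in E}W(X_f^\circ)\ \Big|\ X_{\eta_e(A)}=x_A\text{ for every }A\in\mathcal{A}_k\Big],\qquad\mathbf{x}\in[0,1]^{\mathcal{A}_k},$$ meaning the version obtained by fixing the listed coordinates and integrating out all remaining independent coordinates. When $t(H,W)>0$ (which holds here since $W\ge a>0$), put $q_e^W:=r_e^W/t(H,W)$ and $$\Delta_H(W):=\sum_{e\in E}\|q_e^W-1\|_{L^1([0,1]^{\mathcal{A}_k})}.$$ *)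

theory Defs
  imports "HOL-Probability.Probability"
begin

text \<open>The unit cube \<open>[0,1]\<^sup>I\<close> with Lebesgue measure. The product of Borel measures is completed,
  so that measurability means Lebesgue measurability. Points are functions that are
  \<open>undefined\<close> outside \<open>I\<close>.\<close>

definition cube :: "'i set \<Rightarrow> ('i \<Rightarrow> real) measure" where
  "cube I = completion (PiM I (\<lambda>_. restrict_space lborel {0..1}))"

definition L1_norm :: "'x measure \<Rightarrow> ('x \<Rightarrow> real) \<Rightarrow> real" where
  "L1_norm \<mu> f = (\<integral>x. \<bar>f x\<bar> \<partial>\<mu>)"

definition L2_norm :: "'x measure \<Rightarrow> ('x \<Rightarrow> real) \<Rightarrow> real" where
  "L2_norm \<mu> f = sqrt (\<integral>x. (f x)\<^sup>2 \<partial>\<mu>)"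

definition index_sets :: "nat \<Rightarrow> nat set set" where
  "index_sets k = {A. A \<noteq> {} \<and> A \<subset> {1..k}}"

definition perm_act :: "nat \<Rightarrow> (nat \<Rightarrow> nat) \<Rightarrow> (nat set \<Rightarrow> real) \<Rightarrow> nat set \<Rightarrow> real" where
  "perm_act k \<pi> x = (\<lambda>A\<in>index_sets k. x (inv \<pi> ` A))"

definition hypergraphon :: "nat \<Rightarrow> ((nat set \<Rightarrow> real) \<Rightarrow> real) \<Rightarrow> bool" where
  "hypergraphon k W \<longleftrightarrow>
     W \<in> borel_measurable (cube (index_sets k)) \<and>
     (\<forall>x\<in>space (cube (index_sets k)). W x \<in> {0..1}) \<and>
     (\<forall>\<pi>. \<pi> permutes {1..k} \<longrightarrow> (AE x in cube (index_sets k). W (perm_act k \<pi> x) = W x))"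

definition uniform_hypergraph :: "nat \<Rightarrow> 'v set \<Rightarrow> 'v set set \<Rightarrow> bool" where
  "uniform_hypergraph k V E \<longleftrightarrow> finite V \<and> (\<forall>e\<in>E. e \<subseteq> V \<and> card e = k)"

definition edge_orderings :: "nat \<Rightarrow> 'v set set \<Rightarrow> ('v set \<Rightarrow> nat \<Rightarrow> 'v) \<Rightarrow> bool" where
  "edge_orderings k E \<eta> \<longleftrightarrow> (\<forall>e\<in>E. bij_betw (\<eta> e) {1..k} e)"

definition vertex_sets :: "nat \<Rightarrow> 'v set \<Rightarrow> 'v set set" where
  "vertex_sets k V = {B. B \<noteq> {} \<and> B \<subseteq> V \<and> card B < k}"

definition edge_point ::
  "nat \<Rightarrow> ('v set \<Rightarrow> nat \<Rightarrow> 'v) \<Rightarrow> 'v set \<Rightarrow> ('v set \<Rightarrow> real) \<Rightarrow> nat set \<Rightarrow> real" where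
  "edge_point k \<eta> e X = (\<lambda>A\<in>index_sets k. X (\<eta> e ` A))"

text \<open>The densities below carry the chosen edge orderings \<open>\<eta>\<close> as an explicit parameter.\<close>

definition hom_density ::
  "nat \<Rightarrow> 'v set \<Rightarrow> 'v set set \<Rightarrow> ('v set \<Rightarrow> nat \<Rightarrow> 'v) \<Rightarrow> ((nat set \<Rightarrow> real) \<Rightarrow> real) \<Rightarrow> real" where
  "hom_density k V E \<eta> W = (\<integral>X. (\<Prod>f\<in>E. W (edge_point k \<eta> f X)) \<partial>cube (vertex_sets k V))"

text \<open>The family \<open>(X\<^sub>B)\<close> with \<open>X\<^bsub>\<eta>\<^sub>e(A)\<^esub> = x\<^sub>A\<close> for every index set \<open>A\<close> and with the
  remaining coordinates taken from \<open>Y\<close>. As \<open>A\<close> runs through the index sets, \<open>\<eta>\<^sub>e(A)\<close> runs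
  bijectively through the nonempty proper subsets of \<open>e\<close>, and the \<open>A\<close> belonging to \<open>B\<close>
  is \<open>\<eta>\<^sub>e\<close>'s preimage of \<open>B\<close> in \<open>{1..k}\<close>.\<close>

definition rooted_point ::
  "nat \<Rightarrow> 'v set \<Rightarrow> ('v set \<Rightarrow> nat \<Rightarrow> 'v) \<Rightarrow> 'v set \<Rightarrow> (nat set \<Rightarrow> real) \<Rightarrow> ('v set \<Rightarrow> real)
    \<Rightarrow> 'v set \<Rightarrow> real" where
  "rooted_point k V \<eta> e x Y =
     (\<lambda>B\<in>vertex_sets k V. if B \<subset> e then x (\<eta> e -` B \<inter> {1..k}) else Y B)"

lemma rooted_point_coordinate:
  assumes "uniform_hypergraph k V E" "edge_orderings k E \<eta>" "e \<in> E" "A \<in> index_sets k"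
  shows "rooted_point k V \<eta> e x Y (\<eta> e ` A) = x A"
proof -
  have bij: "bij_betw (\<eta> e) {1..k} e" and sub: "e \<subseteq> V" and fin: "finite e"
    using assms(1-3) by (auto simp: uniform_hypergraph_def edge_orderings_def intro: finite_subset)
  have inj: "inj_on (\<eta> e) {1..k}" and img: "\<eta> e ` {1..k} = e"
    using bij by (auto simp: bij_betw_def)
  have A: "A \<noteq> {}" "A \<subset> {1..k}" using assms(4) by (auto simp: index_sets_def)
  have pre: "\<eta> e -` (\<eta> e ` A) \<inter> {1..k} = A"
  proof (intro set_eqI iffI)
    fix i assume "i \<in> \<eta> e -` (\<eta> e ` A) \<inter> {1..k}"
    then obtain j where "j \<in> A" "\<eta> e i = \<eta> e j" "i \<in> {1..k}" by blast
    with inj_onD[OF inj, of i j] A show "i \<in> A" by blast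
  next
    fix i assume "i \<in> A"
    with A show "i \<in> \<eta> e -` (\<eta> e ` A) \<inter> {1..k}" by blast
  qed
  have ne: "\<eta> e ` A \<noteq> e"
    using A inj_on_image_eq_iff[OF inj, of A "{1..k}"] img by auto
  have le: "\<eta> e ` A \<subseteq> e"
    using image_mono[of A "{1..k}" "\<eta> e"] A img by auto
  have lt: "\<eta> e ` A \<subset> e" using ne le by blast
  have "card e = k" using assms(1,3) by (simp add: uniform_hypergraph_def)
  then have "card (\<eta> e ` A) < k"
    using psubset_card_mono[OF fin lt] by simp
  then have mem: "\<eta> e ` A \<in> vertex_sets k V"
    using A le sub unfolding vertex_sets_def by blast
  show ?thesis
    unfolding rooted_point_def restrict_apply' [OF mem] pre using lt by simp
qed

definition rooted_density ::
  "nat \<Rightarrow> 'v set \<Rightarrow> 'v set set \<Rightarrow> ('v set \<Rightarrow> nat \<Rightarrow> 'v) \<Rightarrow> ((nat set \<Rightarrow> real) \<Rightarrow> real)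
    \<Rightarrow> 'v set \<Rightarrow> (nat set \<Rightarrow> real) \<Rightarrow> real" where
  "rooted_density k V E \<eta> W e x =
     (\<integral>Y. (\<Prod>f\<in>E. W (edge_point k \<eta> f (rooted_point k V \<eta> e x Y)))
        \<partial>cube (vertex_sets k V - {B. B \<subset> e}))"

definition normalized_rooted_density ::
  "nat \<Rightarrow> 'v set \<Rightarrow> 'v set set \<Rightarrow> ('v set \<Rightarrow> nat \<Rightarrow> 'v) \<Rightarrow> ((nat set \<Rightarrow> real) \<Rightarrow> real)
    \<Rightarrow> 'v set \<Rightarrow> (nat set \<Rightarrow> real) \<Rightarrow> real" where
  "normalized_rooted_density k V E \<eta> W e x =
     rooted_density k V E \<eta> W e x / hom_density k V E \<eta> W"

definition rooted_deviation ::
  "nat \<Rightarrow> 'v set \<Rightarrow> 'v set set \<Rightarrow> ('v set \<Rightarrow> nat \<Rightarrow> 'v) \<Rightarrow> ((nat set \<Rightarrow> real) \<Rightarrow> real) \<Rightarrow> real" where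
  "rooted_deviation k V E \<eta> W =
     (\<Sum>e\<in>E. L1_norm (cube (index_sets k)) (\<lambda>x. normalized_rooted_density k V E \<eta> W e x - 1))"

end

theory Submission
  imports Defs
begin

text \<open>Put \<open>u = ln W - \<integral>ln W\<close> and let \<open>X\<close> be the random point of the cube over the vertex sets, with edge
  coordinates \<open>X\<^sub>e\<close>. Let \<open>S = \<Sum>\<^sub>e ln W(X\<^sub>e)\<close>, so that \<open>exp S\<close> is the product of \<open>W\<close> over the edges. The
  variance of \<open>S\<close> is estimated in two ways.

  From above: the law of \<open>X\<close> tilted by \<open>exp S\<close> has, up to the factor \<open>t(H,W)\<close>, the rooted density at \<open>e\<close> as
  marginal density of \<open>X\<^sub>e\<close> (\<open>rooted_density_weighted\<close>). If the normalized rooted densities are close to \<open>1\<close>, then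
  the mean of each \<open>ln W(X\<^sub>e)\<close>, hence that of \<open>S\<close>, hardly changes under the tilt: the change is at most
  \<open>M \<Delta>\<close>. But tilting by \<open>exp S\<close> raises the mean of \<open>S\<close> by at least \<open>exp (- m M)\<close> times its variance, since
  \<open>S \<ge> - m M\<close> and \<open>t(H,W) \<le> 1\<close> (\<open>variance_le_exponential_tilt\<close>). Hence \<open>Var S \<le> exp (m M) M \<Delta>\<close>.

  From below: \<open>Var S\<close> is the sum over pairs of edges of the covariances of \<open>u(X\<^sub>e)\<close> and \<open>u(X\<^sub>f)\<close>. By
  symmetry of \<open>W\<close> the two edges may be ordered so that they agree on their common vertices, and then the
  two values are conditionally independent and identically distributed given the shared coordinates, so the
  covariance is nonnegative (\<open>edge_covariance_nonneg\<close>). The \<open>m\<close> diagonal terms give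
  \<open>Var S \<ge> m \<integral>u\<^sup>2\<close>.

  Together \<open>m \<integral>u\<^sup>2 \<le> exp (m M) M \<Delta>\<close>. The estimates for \<open>W - p\<close> follow because the exponential is
  \<open>1\<close>-Lipschitz on the nonpositive half-line.\<close>

section \<open>Measure-preserving maps between cubes\<close>

definition measure_preserving :: "'x measure \<Rightarrow> 'y measure \<Rightarrow> ('x \<Rightarrow> 'y) \<Rightarrow> bool" where
  "measure_preserving M N T \<longleftrightarrow> T \<in> M \<rightarrow>\<^sub>M N \<and> distr M N T = N"

lemma measure_preservingD:
  assumes "measure_preserving M N T"
  shows "T \<in> M \<rightarrow>\<^sub>M N" "distr M N T = N"
  using assms by (auto simp: measure_preserving_def)

lemma measure_preserving_AE:
  assumes "measure_preserving M N T" "AE y in N. P y"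
  shows "AE x in M. P (T x)"
  using AE_distrD[of T M N P] measure_preservingD[OF assms(1)] assms(2) by metis

lemma measure_preserving_integral:
  fixes f :: "'y \<Rightarrow> real"
  assumes "measure_preserving M N T" "f \<in> borel_measurable N"
  shows "(\<integral>x. f (T x) \<partial>M) = integral\<^sup>L N f"
  using integral_distr[of T M N f] measure_preservingD[OF assms(1)] assms(2) by simp

lemma measure_preserving_integrable:
  fixes f :: "'y \<Rightarrow> real"
  assumes "measure_preserving M N T" "integrable N f"
  shows "integrable M (\<lambda>x. f (T x))"
  using integrable_distr[of T M N f] measure_preservingD[OF assms(1)] assms(2) by simp

text \<open>Preimages of null sets are null, so a measure-preserving map stays measurable for the completed
  \<open>\<sigma>\<close>-algebras. Thus a hypergraphon that is only Lebesgue measurable can still be composed with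
  the coordinate maps of the cube.\<close>

lemma measure_preserving_completion:
  assumes "measure_preserving M N T"
  shows "measure_preserving (completion M) (completion N) T"
proof -
  have T: "T \<in> completion M \<rightarrow>\<^sub>M N"
    using measure_preservingD(1)[OF assms] by (rule measurable_completion)
  have d: "distr (completion M) N T = N"
    using measure_preservingD[OF assms] by (simp add: distr_completion)
  have "T \<in> completion M \<rightarrow>\<^sub>M completion N"
    by (rule completion.measurable_completion2[OF T]) (simp add: d)
  moreover have "distr (completion M) (completion N) T = completion N"
    using completion.completion_distr_eq[OF T] by (simp add: d)
  ultimately show ?thesis by (simp add: measure_preserving_def)
qed

lemma borel_measurable_completion_cong_AE:
  assumes g: "g \<in> borel_measurable (completion M)" and ae: "AE x in completion M. f x = g x"
  shows "f \<in> borel_measurable (completion M)"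
proof (rule measurableI)
  fix A :: "'b set" assume A: "A \<in> sets borel"
  show "f -` A \<inter> space (completion M) \<in> sets (completion M)"
  proof (rule completion.in_sets_AE)
    show "AE x in completion M. x \<in> g -` A \<inter> space (completion M) \<longleftrightarrow> x \<in> f -` A \<inter> space (completion M)"
      using ae AE_space by eventually_elim auto
  next
    show "g -` A \<inter> space (completion M) \<in> sets (completion M)"
      by (rule measurable_sets[OF g A])
  qed auto
qed auto

text \<open>The product theorems (reindexing, merging, Fubini) speak of plain product measures, so they are applied
  to the cube before completion and then transferred.\<close>

definition borel_cube :: "'i set \<Rightarrow> ('i \<Rightarrow> real) measure" where
  "borel_cube I = PiM I (\<lambda>_. restrict_space lborel {0..1})"

lemma cube_eq_completion: "cube I = completion (borel_cube I)"
  by (simp add: cube_def borel_cube_def)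

lemma prob_space_unit_interval: "prob_space (restrict_space lborel {0..1::real})"
  by (rule prob_space_restrict_space) auto

lemma prob_space_borel_cube: "prob_space (borel_cube I)"
  unfolding borel_cube_def by (intro prob_space_PiM prob_space_unit_interval)

lemma prob_space_cube: "prob_space (cube I)"
proof
  show "emeasure (cube I) (space (cube I)) = 1"
    using prob_space.emeasure_space_1[OF prob_space_borel_cube[of I]]
    by (simp add: cube_eq_completion)
qed

lemma measure_preserving_reindex_borel:
  assumes "inj_on \<phi> I" "\<phi> ` I \<subseteq> D"
  shows "measure_preserving (borel_cube D) (borel_cube I) (\<lambda>X. \<lambda>i\<in>I. X (\<phi> i))"
  unfolding measure_preserving_def
proof
  show "(\<lambda>X. \<lambda>i\<in>I. X (\<phi> i)) \<in> borel_cube D \<rightarrow>\<^sub>M borel_cube I"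
    unfolding borel_cube_def
    using assms(2) by (intro measurable_restrict) (auto intro!: measurable_component_singleton)
  show "distr (borel_cube D) (borel_cube I) (\<lambda>X. \<lambda>i\<in>I. X (\<phi> i)) = borel_cube I"
    unfolding borel_cube_def
    using assms by (intro distr_PiM_reindex prob_space_unit_interval) auto
qed

lemma measure_preserving_reindex:
  assumes "inj_on \<phi> I" "\<phi> ` I \<subseteq> D"
  shows "measure_preserving (cube D) (cube I) (\<lambda>X. \<lambda>i\<in>I. X (\<phi> i))"
  unfolding cube_eq_completion
  by (intro measure_preserving_completion measure_preserving_reindex_borel assms)

text \<open>Fubini's theorem for completed measures: on the completion the sections of \<open>F\<close> are measurable only for
  almost every \<open>x\<close>. A Borel representative of \<open>F\<close> agrees with \<open>F\<close> on almost every section, so the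
  iterated integral may be computed with it.\<close>

lemma completion_Fubini:
  fixes F :: "'z \<Rightarrow> real"
  assumes "prob_space M" "prob_space N"
    and T: "measure_preserving (M \<Otimes>\<^sub>M N) R (\<lambda>(x, y). T x y)"
    and F: "integrable (completion R) F"
  shows "integrable (completion M) (\<lambda>x. \<integral>y. F (T x y) \<partial>completion N)" (is ?int)
    and "(\<integral>x. (\<integral>y. F (T x y) \<partial>completion N) \<partial>completion M) = integral\<^sup>L (completion R) F" (is ?eq)
proof -
  interpret M: prob_space M by fact
  interpret N: prob_space N by fact
  interpret MN: pair_prob_space M N ..
  obtain F' where F'[measurable]: "F' \<in> borel_measurable R" and ae: "AE z in R. F z = F' z"
    using completion_ex_borel_measurable_real[of F R] F by blast
  have aec: "AE z in completion R. F z = F' z"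
    using ae by (rule AE_completion)
  have F'c: "F' \<in> borel_measurable (completion R)"
    using F' by (rule measurable_completion)
  have "integrable (completion R) F'"
    by (rule integrable_cong_AE_imp[OF F F'c aec])
  then have intF': "integrable R F'"
    by (simp add: integrable_completion F')
  define G where "G x y = F' (T x y)" for x y
  have intG: "integrable (M \<Otimes>\<^sub>M N) (\<lambda>(x, y). G x y)"
    using measure_preserving_integrable[OF T intF'] by (simp add: G_def case_prod_unfold)
  define g where "g x = (\<integral>y. G x y \<partial>N)" for x
  have intg: "integrable M g"
    using MN.integrable_fst'[OF intG] by (simp add: g_def[abs_def])
  have "AE z in M \<Otimes>\<^sub>M N. F (case z of (x, y) \<Rightarrow> T x y) = F' (case z of (x, y) \<Rightarrow> T x y)"
    by (rule measure_preserving_AE[OF T ae])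
  then have "AE x in M. AE y in N. F (T x y) = G x y"
    using MN.AE_pair[of "\<lambda>z. F (case z of (x, y) \<Rightarrow> T x y) = F' (case z of (x, y) \<Rightarrow> T x y)"]
    by (simp add: G_def)
  moreover have "AE x in M. integrable N (\<lambda>y. G x y)"
    using MN.AE_integrable_fst'[OF intG] by simp
  ultimately have "AE x in M. (\<integral>y. F (T x y) \<partial>completion N) = g x"
  proof eventually_elim
    case (elim x)
    have G: "G x \<in> borel_measurable N" using elim(2) by simp
    have Gc: "G x \<in> borel_measurable (completion N)"
      using G by (rule measurable_completion)
    have eq: "AE y in completion N. F (T x y) = G x y"
      using elim(1) by (rule AE_completion)
    have "(\<integral>y. F (T x y) \<partial>completion N) = (\<integral>y. G x y \<partial>completion N)"
      by (rule integral_cong_AE[OF borel_measurable_completion_cong_AE[OF Gc eq] Gc eq])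
    also have "\<dots> = g x"
      by (simp add: g_def integral_completion G)
    finally show ?case .
  qed
  then have aeg: "AE x in completion M. (\<integral>y. F (T x y) \<partial>completion N) = g x"
    by (rule AE_completion)
  have gc: "integrable (completion M) g"
    using intg by (simp add: integrable_completion)
  have meas: "(\<lambda>x. \<integral>y. F (T x y) \<partial>completion N) \<in> borel_measurable (completion M)"
    by (rule borel_measurable_completion_cong_AE[OF borel_measurable_integrable[OF gc] aeg])
  show ?int
    by (rule integrable_cong_AE_imp[OF gc meas]) (use aeg in \<open>simp add: eq_commute\<close>)
  have "(\<integral>x. (\<integral>y. F (T x y) \<partial>completion N) \<partial>completion M) = integral\<^sup>L (completion M) g"
    by (rule integral_cong_AE[OF meas borel_measurable_integrable[OF gc] aeg])
  also have "\<dots> = integral\<^sup>L M g"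
    using intg by (simp add: integral_completion)
  also have "\<dots> = integral\<^sup>L (M \<Otimes>\<^sub>M N) (\<lambda>(x, y). G x y)"
    using MN.integral_fst'[OF intG] by (simp add: g_def[abs_def])
  also have "\<dots> = integral\<^sup>L R F'"
    using measure_preserving_integral[OF T F'] by (simp add: G_def case_prod_unfold)
  also have "\<dots> = integral\<^sup>L (completion R) F'"
    by (simp add: integral_completion F')
  also have "\<dots> = integral\<^sup>L (completion R) F"
    by (rule integral_cong_AE) (use F F'c aec in \<open>auto simp: eq_commute\<close>)
  finally show ?eq .
qed

text \<open>The coordinates in \<open>J\<close> are read off from \<open>x\<close> through an injection, those in \<open>K\<close> come from \<open>y\<close>;
  injectivity makes them independent uniform variables again. Rooting a density at an edge has this form.\<close>

lemma measure_preserving_merge: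
  fixes I :: "'i set" and J K :: "'j set"
  assumes "finite J" "finite K" "J \<inter> K = {}" "inj_on \<phi> J" "\<phi> ` J \<subseteq> I"
  shows "measure_preserving (borel_cube I \<Otimes>\<^sub>M borel_cube K) (borel_cube (J \<union> K))
           (\<lambda>(x, y). \<lambda>B\<in>J \<union> K. if B \<in> J then x (\<phi> B) else y B)"
proof -
  interpret product_sigma_finite "\<lambda>_::'j. restrict_space lborel {0..1::real}"
    by (simp add: product_sigma_finite_def prob_space_imp_sigma_finite prob_space_unit_interval)
  define \<rho> where "\<rho> x = (\<lambda>B\<in>J. x (\<phi> B))" for x :: "'i \<Rightarrow> real"
  have \<rho>: "\<rho> \<in> borel_cube I \<rightarrow>\<^sub>M borel_cube J" "distr (borel_cube I) (borel_cube J) \<rho> = borel_cube J"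
    using measure_preserving_reindex_borel[OF assms(4,5)]
    by (auto simp: measure_preserving_def \<rho>_def[abs_def])
  have id: "distr (borel_cube K) (borel_cube K) (\<lambda>y. y) = borel_cube K"
    by (simp add: distr_id2)
  have "borel_cube J \<Otimes>\<^sub>M borel_cube K =
      distr (borel_cube I \<Otimes>\<^sub>M borel_cube K) (borel_cube J \<Otimes>\<^sub>M borel_cube K) (\<lambda>(x, y). (\<rho> x, y))"
    using pair_measure_distr[OF \<rho>(1) measurable_ident_sets[OF refl], of "borel_cube K"]
    by (simp add: id \<rho>(2) prob_space_imp_sigma_finite prob_space_borel_cube)
  then have pre: "measure_preserving (borel_cube I \<Otimes>\<^sub>M borel_cube K) (borel_cube J \<Otimes>\<^sub>M borel_cube K)
      (\<lambda>(x, y). (\<rho> x, y))"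
    using \<rho>(1) by (simp add: measure_preserving_def)
  have mer: "merge J K \<in> borel_cube J \<Otimes>\<^sub>M borel_cube K \<rightarrow>\<^sub>M borel_cube (J \<union> K)"
    unfolding borel_cube_def by (rule measurable_merge)
  have "distr (borel_cube J \<Otimes>\<^sub>M borel_cube K) (borel_cube (J \<union> K)) (merge J K) = borel_cube (J \<union> K)"
    unfolding borel_cube_def by (rule distr_merge) (use assms in auto)
  then have "measure_preserving (borel_cube I \<Otimes>\<^sub>M borel_cube K) (borel_cube (J \<union> K))
      (merge J K \<circ> (\<lambda>(x, y). (\<rho> x, y)))"
    using distr_distr[OF mer measure_preservingD(1)[OF pre]] measure_preservingD[OF pre] mer
    by (auto simp: measure_preserving_def intro: measurable_comp)
  moreover have "merge J K \<circ> (\<lambda>(x, y). (\<rho> x, y)) =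
      (\<lambda>(x, y). \<lambda>B\<in>J \<union> K. if B \<in> J then x (\<phi> B) else y B)"
    using assms(3) by (auto simp: fun_eq_iff merge_def \<rho>_def restrict_def)
  ultimately show ?thesis by simp
qed

section \<open>Covariances of agreeing copies\<close>

lemma bounded_integrable_cube:
  fixes f :: "_ \<Rightarrow> real"
  assumes "f \<in> borel_measurable (cube I)" "AE x in cube I. \<bar>f x\<bar> \<le> B"
  shows "integrable (cube I) f"
proof -
  interpret prob_space "cube I" by (rule prob_space_cube)
  show ?thesis by (rule integrable_const_bound[of _ B]) (use assms in auto)
qed

text \<open>The joint law of \<open>X \<circ> \<phi>\<close> and \<open>X \<circ> \<psi>\<close> depends only on which coordinates the two injections share,
  because all coordinates are independent with the same law.\<close>

lemma joint_law_reindex: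
  fixes v :: "('i \<Rightarrow> real) \<Rightarrow> real" and D :: "'d set" and U :: "'u set"
  assumes v: "v \<in> borel_measurable (cube I)"
    and \<phi>: "inj_on \<phi> I" "\<phi> ` I \<subseteq> D" and \<psi>: "inj_on \<psi> I" "\<psi> ` I \<subseteq> D"
    and \<kappa>: "inj_on \<kappa> I" "\<kappa> ` I \<subseteq> U" and \<mu>: "inj_on \<mu> I" "\<mu> ` I \<subseteq> U"
    and same: "\<And>i j. i \<in> I \<Longrightarrow> j \<in> I \<Longrightarrow> \<phi> i = \<psi> j \<longleftrightarrow> \<kappa> i = \<mu> j"
  shows "(\<integral>X. v (\<lambda>i\<in>I. X (\<kappa> i)) * v (\<lambda>i\<in>I. X (\<mu> i)) \<partial>cube U)
       = (\<integral>X. v (\<lambda>i\<in>I. X (\<phi> i)) * v (\<lambda>i\<in>I. X (\<psi> i)) \<partial>cube D)"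
proof -
  define D' where "D' = \<phi> ` I \<union> \<psi> ` I"
  \<comment> \<open>the injection that carries \<open>(\<phi>, \<psi>)\<close> to \<open>(\<kappa>, \<mu>)\<close>; the hypothesis on coincidences makes it well defined\<close>
  define \<theta> where "\<theta> d = (if d \<in> \<phi> ` I then \<kappa> (inv_into I \<phi> d) else \<mu> (inv_into I \<psi> d))" for d
  have \<theta>\<phi>: "\<theta> (\<phi> i) = \<kappa> i" if "i \<in> I" for i
    using that \<phi>(1) by (simp add: \<theta>_def)
  have \<theta>\<psi>: "\<theta> (\<psi> j) = \<mu> j" if j: "j \<in> I" for j
  proof (cases "\<psi> j \<in> \<phi> ` I")
    case True
    then obtain i where i: "i \<in> I" "\<psi> j = \<phi> i" by blast
    then have "\<kappa> i = \<mu> j" using same[of i j] j by simp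
    then show ?thesis using \<theta>\<phi>[OF i(1)] i(2) by simp
  next
    case False
    then show ?thesis using j \<psi>(1) by (simp add: \<theta>_def)
  qed
  have inj: "inj_on \<theta> D'"
  proof (rule inj_onI)
    fix d d' assume dd: "d \<in> D'" "d' \<in> D'" and eq: "\<theta> d = \<theta> d'"
    have "\<phi> i = \<phi> j" if "i \<in> I" "j \<in> I" "\<theta> (\<phi> i) = \<theta> (\<phi> j)" for i j
      using that \<kappa>(1) by (simp add: \<theta>\<phi> inj_on_eq_iff)
    moreover have "\<psi> i = \<psi> j" if "i \<in> I" "j \<in> I" "\<theta> (\<psi> i) = \<theta> (\<psi> j)" for i j
      using that \<mu>(1) by (simp add: \<theta>\<psi> inj_on_eq_iff)
    moreover have "\<phi> i = \<psi> j" if "i \<in> I" "j \<in> I" "\<theta> (\<phi> i) = \<theta> (\<psi> j)" for i j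
      using that same by (simp add: \<theta>\<phi> \<theta>\<psi>)
    moreover have "\<psi> i = \<phi> j" if "i \<in> I" "j \<in> I" "\<theta> (\<psi> i) = \<theta> (\<phi> j)" for i j
      using that same[of j i] by (metis \<theta>\<phi> \<theta>\<psi>)
    moreover have "(\<exists>i\<in>I. d = \<phi> i) \<or> (\<exists>i\<in>I. d = \<psi> i)" "(\<exists>j\<in>I. d' = \<phi> j) \<or> (\<exists>j\<in>I. d' = \<psi> j)"
      using dd by (auto simp: D'_def)
    ultimately show "d = d'"
      using eq by (elim disjE bexE) auto
  qed
  have sub: "\<theta> ` D' \<subseteq> U"
    using \<kappa>(2) \<mu>(2) by (auto simp: D'_def \<theta>\<phi> \<theta>\<psi>)
  have rU: "measure_preserving (cube U) (cube D') (\<lambda>X. \<lambda>d\<in>D'. X (\<theta> d))"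
    by (rule measure_preserving_reindex[OF inj sub])
  have rD: "measure_preserving (cube D) (cube D') (\<lambda>X. \<lambda>d\<in>D'. X d)"
    by (rule measure_preserving_reindex) (use \<phi> \<psi> in \<open>auto simp: D'_def\<close>)
  define F where "F Y = v (\<lambda>i\<in>I. Y (\<phi> i)) * v (\<lambda>i\<in>I. Y (\<psi> i))" for Y
  have "(\<lambda>Y. \<lambda>i\<in>I. Y (\<phi> i)) \<in> cube D' \<rightarrow>\<^sub>M cube I"
    by (rule measure_preservingD(1)[OF measure_preserving_reindex]) (use \<phi> in \<open>auto simp: D'_def\<close>)
  moreover have "(\<lambda>Y. \<lambda>i\<in>I. Y (\<psi> i)) \<in> cube D' \<rightarrow>\<^sub>M cube I"
    by (rule measure_preservingD(1)[OF measure_preserving_reindex]) (use \<psi> in \<open>auto simp: D'_def\<close>)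
  ultimately have F: "F \<in> borel_measurable (cube D')"
    unfolding F_def using v by (intro borel_measurable_times measurable_compose[OF _ v])
  have 1: "(\<lambda>i\<in>I. (\<lambda>d\<in>D'. X (\<theta> d)) (\<phi> i)) = (\<lambda>i\<in>I. X (\<kappa> i))"
       "(\<lambda>i\<in>I. (\<lambda>d\<in>D'. X (\<theta> d)) (\<psi> i)) = (\<lambda>i\<in>I. X (\<mu> i))" for X :: "'u \<Rightarrow> real"
    by (auto simp: fun_eq_iff D'_def \<theta>\<phi> \<theta>\<psi>)
  have 2: "(\<lambda>i\<in>I. (\<lambda>d\<in>D'. X d) (\<phi> i)) = (\<lambda>i\<in>I. X (\<phi> i))"
       "(\<lambda>i\<in>I. (\<lambda>d\<in>D'. X d) (\<psi> i)) = (\<lambda>i\<in>I. X (\<psi> i))" for X :: "'d \<Rightarrow> real"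
    by (auto simp: fun_eq_iff D'_def)
  show ?thesis
    using measure_preserving_integral[OF rU F] measure_preserving_integral[OF rD F]
    unfolding F_def 1 2 by simp
qed

lemma nonneg_of_scaled_bound:
  fixes C Q :: real
  assumes "\<And>n. 0 \<le> Q + real n * C"
  shows "0 \<le> C"
proof (rule ccontr)
  assume "\<not> 0 \<le> C"
  then have "0 < - C" by simp
  then obtain n where "Q < real n * (- C)" using reals_Archimedean3 by blast
  with assms[of n] show False by simp
qed

text \<open>Given the shared coordinates, \<open>X \<circ> \<phi>\<close> and \<open>X \<circ> \<psi>\<close> are conditionally independent with the same
  conditional law, because a shared coordinate sits in the same position of both; so the integral is that of a
  squared conditional expectation. Conditioning is avoided by exchangeability: \<open>n + 1\<close> copies sharing exactly
  these coordinates satisfy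
  \<open>0 \<le> \<integral>(\<Sum>r\<le>n. v\<^sub>r)\<^sup>2 = (n + 1) (Q + n C)\<close>, where \<open>Q\<close> is the second moment of \<open>v\<close> and \<open>C\<close> the integral in
  question. This holds for all \<open>n\<close>, which forces \<open>C \<ge> 0\<close>.\<close>

lemma covariance_agreeing_reindex_nonneg:
  fixes v :: "('i \<Rightarrow> real) \<Rightarrow> real"
  assumes v: "v \<in> borel_measurable (cube I)" and bdd: "AE x in cube I. \<bar>v x\<bar> \<le> B"
    and \<phi>: "inj_on \<phi> I" "\<phi> ` I \<subseteq> D" and \<psi>: "inj_on \<psi> I" "\<psi> ` I \<subseteq> D"
    and agree: "\<And>i j. i \<in> I \<Longrightarrow> j \<in> I \<Longrightarrow> \<phi> i = \<psi> j \<Longrightarrow> i = j"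
  shows "0 \<le> (\<integral>X. v (\<lambda>i\<in>I. X (\<phi> i)) * v (\<lambda>i\<in>I. X (\<psi> i)) \<partial>cube D)" (is "0 \<le> ?C")
proof -
  define Q where "Q = (\<integral>x. (v x)\<^sup>2 \<partial>cube I)"
  have "0 \<le> Q + real n * ?C" for n
  proof -
    define U where "U = (UNIV :: ('i \<times> nat) set)"
    \<comment> \<open>copy \<open>r\<close> of coordinate \<open>i\<close>: level \<open>0\<close> is common to all copies, level \<open>Suc r\<close> is private to copy \<open>r\<close>\<close>
    define \<kappa> where "\<kappa> r i = (i, if \<phi> i = \<psi> i then 0 else Suc r)" for r i
    have \<kappa>inj: "inj_on (\<kappa> r) I" and \<kappa>sub: "\<kappa> r ` I \<subseteq> U" for r
      by (auto simp: \<kappa>_def inj_on_def U_def)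
    have mp: "measure_preserving (cube U) (cube I) (\<lambda>X. \<lambda>i\<in>I. X (\<kappa> r i))" for r
      by (rule measure_preserving_reindex[OF \<kappa>inj \<kappa>sub])
    define w where "w r X = v (\<lambda>i\<in>I. X (\<kappa> r i))" for r and X :: "'i \<times> nat \<Rightarrow> real"
    have wm: "w r \<in> borel_measurable (cube U)" for r
      unfolding w_def by (rule measurable_compose[OF measure_preservingD(1)[OF mp] v])
    have wb: "AE X in cube U. \<bar>w r X\<bar> \<le> B" for r
      unfolding w_def by (rule measure_preserving_AE[OF mp bdd])
    have wint: "integrable (cube U) (\<lambda>X. w r X * w s X)" for r s
    proof (rule bounded_integrable_cube)
      show "AE X in cube U. \<bar>w r X * w s X\<bar> \<le> B * B"
        using wb[of r] wb[of s] by eventually_elim (auto simp: abs_mult intro: mult_mono)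
    qed (use wm in simp)
    have diag: "(\<integral>X. w r X * w r X \<partial>cube U) = Q" for r
      using measure_preserving_integral[OF mp[of r], of "\<lambda>x. (v x)\<^sup>2"] v
      by (simp add: w_def Q_def power2_eq_square)
    have off: "(\<integral>X. w r X * w s X \<partial>cube U) = ?C" if "r \<noteq> s" for r s
      unfolding w_def
    proof (rule joint_law_reindex[OF v \<phi> \<psi> \<kappa>inj \<kappa>sub \<kappa>inj \<kappa>sub])
      fix i j assume "i \<in> I" "j \<in> I"
      then show "\<phi> i = \<psi> j \<longleftrightarrow> \<kappa> r i = \<kappa> s j"
        using agree[of i j] that by (auto simp: \<kappa>_def)
    qed
    have "0 \<le> (\<integral>X. (\<Sum>r\<le>n. w r X)\<^sup>2 \<partial>cube U)"
      by simp
    also have "\<dots> = (\<integral>X. (\<Sum>r\<le>n. \<Sum>s\<le>n. w r X * w s X) \<partial>cube U)"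
      by (simp add: power2_eq_square sum_product)
    also have "\<dots> = (\<Sum>r\<le>n. \<Sum>s\<le>n. (\<integral>X. w r X * w s X \<partial>cube U))"
      by (simp add: wint)
    also have "\<dots> = (\<Sum>r\<le>n. \<Sum>s\<le>n. (if r = s then Q - ?C else 0) + ?C)"
      by (intro sum.cong refl) (auto simp: diag off)
    also have "\<dots> = real (Suc n) * (Q + real n * ?C)"
      by (simp add: sum.distrib algebra_simps)
    finally show ?thesis
      by (simp add: zero_le_mult_iff)
  qed
  then show ?thesis by (rule nonneg_of_scaled_bound)
qed

section \<open>Covariances between edges of a hypergraph\<close>

lemma finite_vertex_sets: "finite V \<Longrightarrow> finite (vertex_sets k V)"
  by (rule finite_subset[of _ "Pow V"]) (auto simp: vertex_sets_def)

lemma inj_on_image_index_sets: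
  assumes "inj_on h {1..k}"
  shows "inj_on ((`) h) (index_sets k)"
proof -
  have "inj_on ((`) h) (Pow {1..k})" using assms by (rule inj_on_image_Pow)
  then show ?thesis by (rule inj_on_subset) (auto simp: index_sets_def)
qed

lemma image_index_sets:
  assumes h: "bij_betw h {1..k} e" and e: "e \<subseteq> V" and fin: "finite V"
  shows "(`) h ` index_sets k \<subseteq> vertex_sets k V"
proof clarify
  fix A assume A: "A \<in> index_sets k"
  then have "finite A" "card A < k"
    using psubset_card_mono[of "{1..k}" A] by (auto simp: index_sets_def intro: finite_subset)
  then show "h ` A \<in> vertex_sets k V"
    using A h e card_image_le[of A h]
    by (auto simp: vertex_sets_def index_sets_def bij_betw_def)
qed

lemma measure_preserving_edge:
  assumes "bij_betw h {1..k} e" "e \<subseteq> V" "finite V"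
  shows "measure_preserving (cube (vertex_sets k V)) (cube (index_sets k)) (\<lambda>X. \<lambda>A\<in>index_sets k. X (h ` A))"
  using assms
  by (intro measure_preserving_reindex image_index_sets inj_on_image_index_sets) (auto simp: bij_betw_def)

text \<open>On the positions that \<open>g\<close> sends into \<open>f\<close> the requirement is a partial injection of \<open>{1..k}\<close>; any
  partial injection of a finite set extends to a permutation.\<close>

lemma exists_permutation_aligning_orderings:
  assumes g: "bij_betw g {1..k::nat} e" and h: "bij_betw h {1..k} f"
  shows "\<exists>\<sigma>. \<sigma> permutes {1..k} \<and> (\<forall>i\<in>{1..k}. g i \<in> f \<longrightarrow> h (\<sigma> i) = g i)"
proof -
  define I where "I = {i\<in>{1..k}. g i \<in> f}"
  define \<tau> where "\<tau> i = inv_into {1..k} h (g i)" for i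
  have himg: "h ` {1..k} = f" and ginj: "inj_on g {1..k}" using g h by (auto simp: bij_betw_def)
  have \<tau>: "\<tau> i \<in> {1..k}" "h (\<tau> i) = g i" if "i \<in> I" for i
    using that inv_into_into[of "g i" h "{1..k}"] f_inv_into_f[of "g i" h "{1..k}"]
    unfolding \<tau>_def I_def himg by auto
  have \<tau>inj: "inj_on \<tau> I"
  proof (rule inj_onI)
    fix i j assume ij: "i \<in> I" "j \<in> I" "\<tau> i = \<tau> j"
    then have "g i = g j" using \<tau>(2) by metis
    then show "i = j" using inj_onD[OF ginj, of i j] ij by (auto simp: I_def)
  qed
  have sub: "I \<subseteq> {1..k}" "\<tau> ` I \<subseteq> {1..k}" using \<tau>(1) by (auto simp: I_def)
  have "finite I" using sub(1) by (rule finite_subset) simp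
  then have "card ({1..k} - I) = card ({1..k} - \<tau> ` I)"
    using sub \<tau>inj by (simp add: card_Diff_subset card_image)
  then obtain \<rho> where \<rho>: "bij_betw \<rho> ({1..k} - I) ({1..k} - \<tau> ` I)"
    using finite_same_card_bij[of "{1..k} - I" "{1..k} - \<tau> ` I"] by auto
  define \<sigma> where "\<sigma> i = (if i \<in> {1..k} then if i \<in> I then \<tau> i else \<rho> i else i)" for i
  have "bij_betw \<sigma> I (\<tau> ` I)"
    using \<tau>inj sub(1) by (intro bij_betw_cong[THEN iffD1, OF _ inj_on_imp_bij_betw]) (auto simp: \<sigma>_def)
  moreover have "bij_betw \<sigma> ({1..k} - I) ({1..k} - \<tau> ` I)"
    by (rule bij_betw_cong[THEN iffD1, OF _ \<rho>]) (auto simp: \<sigma>_def)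
  ultimately have "bij_betw \<sigma> (I \<union> ({1..k} - I)) (\<tau> ` I \<union> ({1..k} - \<tau> ` I))"
    by (rule bij_betw_combine) auto
  then have "bij_betw \<sigma> {1..k} {1..k}"
    using sub by (simp add: Un_absorb1)
  then have "\<sigma> permutes {1..k}"
    by (rule bij_imp_permutes) (auto simp: \<sigma>_def)
  moreover have "\<forall>i\<in>{1..k}. g i \<in> f \<longrightarrow> h (\<sigma> i) = g i"
    using \<tau>(2) by (auto simp: \<sigma>_def I_def)
  ultimately show ?thesis by blast
qed

text \<open>By symmetry \<open>f\<close> may be reordered without changing \<open>u (X\<^sub>f)\<close> almost surely. Ordered so as to agree with
  \<open>\<eta> e\<close> on the common vertices, the two edges read each shared coordinate in the same position.
  Symmetry is essential: with \<open>k = 2\<close> and \<open>u(x) = x\<^sub>1 - x\<^sub>2\<close> (indexed by the two endpoints), the two edges of a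
  directed path have negative covariance.\<close>

lemma edge_covariance_nonneg:
  fixes u :: "(nat set \<Rightarrow> real) \<Rightarrow> real"
  assumes u: "u \<in> borel_measurable (cube (index_sets k))"
    and bdd: "AE x in cube (index_sets k). \<bar>u x\<bar> \<le> B"
    and sym: "\<And>\<pi>. \<pi> permutes {1..k} \<Longrightarrow> AE x in cube (index_sets k). u (perm_act k \<pi> x) = u x"
    and H: "uniform_hypergraph k V E" "edge_orderings k E \<eta>" and ef: "e \<in> E" "f \<in> E"
  shows "0 \<le> (\<integral>X. u (edge_point k \<eta> e X) * u (edge_point k \<eta> f X) \<partial>cube (vertex_sets k V))"
proof -
  let ?I = "index_sets k" and ?D = "vertex_sets k V"
  have fin: "finite V" and sub: "e \<subseteq> V" "f \<subseteq> V"
    and be: "bij_betw (\<eta> e) {1..k} e" and bf: "bij_betw (\<eta> f) {1..k} f"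
    using H ef by (auto simp: uniform_hypergraph_def edge_orderings_def)
  obtain \<sigma> where \<sigma>: "\<sigma> permutes {1..k}" "\<And>i. i \<in> {1..k} \<Longrightarrow> \<eta> e i \<in> f \<Longrightarrow> \<eta> f (\<sigma> i) = \<eta> e i"
    using exists_permutation_aligning_orderings[OF be bf] by blast
  have bfs: "bij_betw (\<eta> f \<circ> \<sigma>) {1..k} f"
    using \<sigma>(1) bf by (metis bij_betw_trans permutes_imp_bij)
  have sinv: "inv (inv \<sigma>) = \<sigma>"
    using \<sigma>(1) by (simp add: permutes_bij inv_inv_eq)
  have mpe: "measure_preserving (cube ?D) (cube ?I) (\<lambda>X. \<lambda>A\<in>?I. X (\<eta> e ` A))"
    by (rule measure_preserving_edge[OF be sub(1) fin])
  have mpf: "measure_preserving (cube ?D) (cube ?I) (\<lambda>X. \<lambda>A\<in>?I. X (\<eta> f ` A))"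
    by (rule measure_preserving_edge[OF bf sub(2) fin])
  have mps: "measure_preserving (cube ?D) (cube ?I) (\<lambda>X. \<lambda>A\<in>?I. X ((\<eta> f \<circ> \<sigma>) ` A))"
    by (rule measure_preserving_edge[OF bfs sub(2) fin])
  have act: "perm_act k (inv \<sigma>) (edge_point k \<eta> f X) = (\<lambda>A\<in>?I. X ((\<eta> f \<circ> \<sigma>) ` A))" for X
  proof -
    have "\<sigma> ` A \<in> ?I" if "A \<in> ?I" for A
    proof -
      have "\<sigma> ` A \<subset> \<sigma> ` {1..k}"
        using that permutes_inj[OF \<sigma>(1)] by (auto simp: index_sets_def image_strict_mono inj_on_subset)
      then show ?thesis
        using that permutes_image[OF \<sigma>(1)] by (auto simp: index_sets_def)
    qed
    then show ?thesis
      by (auto simp: perm_act_def edge_point_def sinv image_comp fun_eq_iff)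
  qed
  have "inv \<sigma> permutes {1..k}" using \<sigma>(1) by (rule permutes_inv)
  from measure_preserving_AE[OF mpf sym[OF this]]
  have ae: "AE X in cube ?D. u (\<lambda>A\<in>?I. X ((\<eta> f \<circ> \<sigma>) ` A)) = u (edge_point k \<eta> f X)"
    using act by (simp add: edge_point_def)
  have "0 \<le> (\<integral>X. u (\<lambda>A\<in>?I. X (\<eta> e ` A)) * u (\<lambda>A\<in>?I. X ((\<eta> f \<circ> \<sigma>) ` A)) \<partial>cube ?D)"
  proof (rule covariance_agreeing_reindex_nonneg[OF u bdd])
    show "inj_on ((`) (\<eta> e)) ?I" "inj_on ((`) (\<eta> f \<circ> \<sigma>)) ?I"
      using be bfs by (auto intro!: inj_on_image_index_sets simp: bij_betw_def)
    show "(`) (\<eta> e) ` ?I \<subseteq> ?D" by (rule image_index_sets[OF be sub(1) fin])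
    show "(`) (\<eta> f \<circ> \<sigma>) ` ?I \<subseteq> ?D" by (rule image_index_sets[OF bfs sub(2) fin])
    fix A A' assume A: "A \<in> ?I" "A' \<in> ?I" and eq: "\<eta> e ` A = (\<eta> f \<circ> \<sigma>) ` A'"
    \<comment> \<open>the shared set lies in both edges, where the two orderings agree\<close>
    have "\<eta> e ` A \<subseteq> f"
      using eq A(2) bfs by (auto simp: index_sets_def bij_betw_def)
    then have "(\<eta> f \<circ> \<sigma>) ` A = \<eta> e ` A"
      using A(1) by (intro image_cong) (auto simp: index_sets_def intro!: \<sigma>(2))
    then have "(\<eta> f \<circ> \<sigma>) ` A = (\<eta> f \<circ> \<sigma>) ` A'" using eq by simp
    then show "A = A'"
      by (rule inj_onD[OF inj_on_image_index_sets[OF bij_betw_imp_inj_on[OF bfs]] _ A])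
  qed
  also have "\<dots> = (\<integral>X. u (edge_point k \<eta> e X) * u (edge_point k \<eta> f X) \<partial>cube ?D)"
  proof (rule integral_cong_AE)
    have [measurable]: "(\<lambda>X. u (\<lambda>A\<in>?I. X (\<eta> e ` A))) \<in> borel_measurable (cube ?D)"
      "(\<lambda>X. u (\<lambda>A\<in>?I. X ((\<eta> f \<circ> \<sigma>) ` A))) \<in> borel_measurable (cube ?D)"
      "(\<lambda>X. u (\<lambda>A\<in>?I. X (\<eta> f ` A))) \<in> borel_measurable (cube ?D)"
      using measurable_compose[OF measure_preservingD(1)[OF mpe] u]
        measurable_compose[OF measure_preservingD(1)[OF mps] u]
        measurable_compose[OF measure_preservingD(1)[OF mpf] u] by auto
    show "(\<lambda>X. u (\<lambda>A\<in>?I. X (\<eta> e ` A)) * u (\<lambda>A\<in>?I. X ((\<eta> f \<circ> \<sigma>) ` A))) \<in> borel_measurable (cube ?D)"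
      "(\<lambda>X. u (edge_point k \<eta> e X) * u (edge_point k \<eta> f X)) \<in> borel_measurable (cube ?D)"
      unfolding edge_point_def by measurable
    show "AE X in cube ?D. u (\<lambda>A\<in>?I. X (\<eta> e ` A)) * u (\<lambda>A\<in>?I. X ((\<eta> f \<circ> \<sigma>) ` A))
        = u (edge_point k \<eta> e X) * u (edge_point k \<eta> f X)"
      using ae by eventually_elim (simp add: edge_point_def)
  qed
  finally show ?thesis .
qed

section \<open>Rooted densities\<close>

lemma rooted_point_measure_preserving:
  assumes H: "uniform_hypergraph k V E" "edge_orderings k E \<eta>" "e \<in> E"
  shows "measure_preserving
      (borel_cube (index_sets k) \<Otimes>\<^sub>M borel_cube (vertex_sets k V - {B. B \<subset> e}))
      (borel_cube (vertex_sets k V)) (\<lambda>(x, Y). rooted_point k V \<eta> e x Y)"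
proof -
  let ?D = "vertex_sets k V"
  define J where "J = ?D \<inter> {B. B \<subset> e}"
  define K where "K = ?D - {B. B \<subset> e}"
  define \<phi> where "\<phi> B = \<eta> e -` B \<inter> {1..k}" for B
  have be: "bij_betw (\<eta> e) {1..k} e" using H by (simp add: edge_orderings_def)
  have fin: "finite ?D" using H by (intro finite_vertex_sets) (simp add: uniform_hypergraph_def)
  have img: "\<eta> e ` \<phi> B = B" if "B \<in> J" for B
  proof -
    have "B \<subseteq> \<eta> e ` {1..k}" using that be by (auto simp: J_def bij_betw_def)
    then show ?thesis unfolding \<phi>_def by blast
  qed
  have JK: "J \<union> K = ?D" by (auto simp: J_def K_def)
  have "measure_preserving (borel_cube (index_sets k) \<Otimes>\<^sub>M borel_cube K) (borel_cube (J \<union> K))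
      (\<lambda>(x, Y). \<lambda>B\<in>J \<union> K. if B \<in> J then x (\<phi> B) else Y B)"
  proof (rule measure_preserving_merge)
    show "finite J" "finite K" "J \<inter> K = {}" using fin by (auto simp: J_def K_def)
    show "inj_on \<phi> J" by (rule inj_on_inverseI[of _ "(`) (\<eta> e)"]) (rule img)
    show "\<phi> ` J \<subseteq> index_sets k"
    proof
      fix A assume "A \<in> \<phi> ` J"
      then obtain B where B: "B \<in> J" "A = \<phi> B" by blast
      have "B \<noteq> {}" "B \<noteq> e" using B(1) by (auto simp: J_def vertex_sets_def)
      moreover have "\<eta> e ` A = B" using img[OF B(1)] B(2) by simp
      moreover have "\<eta> e ` {1..k} = e" using be by (simp add: bij_betw_def)
      moreover have "A \<subseteq> {1..k}" by (simp add: B(2) \<phi>_def)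
      ultimately show "A \<in> index_sets k" unfolding index_sets_def by blast
    qed
  qed
  moreover have "(\<lambda>(x, Y). \<lambda>B\<in>J \<union> K. if B \<in> J then x (\<phi> B) else Y B)
      = (\<lambda>(x, Y). rooted_point k V \<eta> e x Y)"
    unfolding JK by (auto simp: fun_eq_iff rooted_point_def J_def \<phi>_def)
  ultimately show ?thesis by (simp only: JK K_def[symmetric])
qed

text \<open>Hence a factor that depends on the root edge alone comes out of the integral over the remaining coordinates.\<close>

lemma edge_point_rooted_point:
  assumes H: "uniform_hypergraph k V E" "edge_orderings k E \<eta>" "e \<in> E"
    and x: "x \<in> space (cube (index_sets k))"
  shows "edge_point k \<eta> e (rooted_point k V \<eta> e x Y) = x"
proof -
  have "x \<in> extensional (index_sets k)"
    using x by (auto simp: cube_eq_completion borel_cube_def space_PiM PiE_def)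
  then show ?thesis
    using rooted_point_coordinate[OF H]
    by (auto simp: edge_point_def fun_eq_iff extensional_def)
qed

text \<open>Up to normalization, the rooted density at \<open>e\<close> is the marginal density of \<open>X\<^sub>e\<close> under the law whose density
  is the product of \<open>W\<close> over all edges.\<close>

lemma rooted_density_weighted:
  fixes w :: "(nat set \<Rightarrow> real) \<Rightarrow> real"
  assumes H: "uniform_hypergraph k V E" "edge_orderings k E \<eta>" "e \<in> E"
    and int: "integrable (cube (vertex_sets k V))
                (\<lambda>X. (\<Prod>f\<in>E. W (edge_point k \<eta> f X)) * w (edge_point k \<eta> e X))"
  shows "integrable (cube (index_sets k)) (\<lambda>x. rooted_density k V E \<eta> W e x * w x)"
    and "(\<integral>x. rooted_density k V E \<eta> W e x * w x \<partial>cube (index_sets k))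
       = (\<integral>X. (\<Prod>f\<in>E. W (edge_point k \<eta> f X)) * w (edge_point k \<eta> e X) \<partial>cube (vertex_sets k V))"
proof -
  let ?I = "cube (index_sets k)" and ?K = "cube (vertex_sets k V - {B. B \<subset> e})"
  define F where "F X = (\<Prod>f\<in>E. W (edge_point k \<eta> f X)) * w (edge_point k \<eta> e X)" for X
  have intF: "integrable (completion (borel_cube (vertex_sets k V))) F"
    using int by (simp add: F_def[abs_def] cube_eq_completion)
  have eq: "rooted_density k V E \<eta> W e x * w x = (\<integral>Y. F (rooted_point k V \<eta> e x Y) \<partial>?K)"
    if "x \<in> space ?I" for x
    using edge_point_rooted_point[OF H that] by (simp add: F_def rooted_density_def)
  note fub = completion_Fubini[OF prob_space_borel_cube prob_space_borel_cube
      rooted_point_measure_preserving[OF H] intF, folded cube_eq_completion]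
  show "integrable ?I (\<lambda>x. rooted_density k V E \<eta> W e x * w x)"
    using fub(1) Bochner_Integration.integrable_cong[OF refl eq, of ?I] by simp
  have "(\<integral>x. rooted_density k V E \<eta> W e x * w x \<partial>?I) = (\<integral>x. (\<integral>Y. F (rooted_point k V \<eta> e x Y) \<partial>?K) \<partial>?I)"
    by (rule Bochner_Integration.integral_cong[OF refl eq])
  also have "\<dots> = integral\<^sup>L (cube (vertex_sets k V)) F" by (rule fub(2))
  finally show "(\<integral>x. rooted_density k V E \<eta> W e x * w x \<partial>?I)
       = (\<integral>X. (\<Prod>f\<in>E. W (edge_point k \<eta> f X)) * w (edge_point k \<eta> e X) \<partial>cube (vertex_sets k V))"
    by (simp add: F_def[abs_def])
qed

section \<open>Exponential tilting and norms\<close>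

text \<open>On \<open>[-L, \<infinity>)\<close> the derivative of the exponential is at least \<open>exp (- L)\<close>.\<close>

lemma exp_strong_monotone:
  fixes x y L :: real
  assumes "- L \<le> x" "- L \<le> y"
  shows "exp (- L) * (x - y)\<^sup>2 \<le> (exp x - exp y) * (x - y)"
proof -
  have *: "exp (- L) * (x - y)\<^sup>2 \<le> (exp x - exp y) * (x - y)" if "y \<le> x" "- L \<le> y" for x y :: real
  proof -
    have "exp (- L) * (x - y) \<le> exp y * (x - y)"
      using that by (intro mult_right_mono) auto
    also have "\<dots> \<le> exp y * (exp (x - y) - 1)"
    proof (rule mult_left_mono)
      show "x - y \<le> exp (x - y) - 1" using exp_ge_add_one_self[of "x - y"] by linarith
    qed simp
    also have "\<dots> = exp x - exp y"
      by (simp add: algebra_simps flip: exp_add)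
    finally have "exp (- L) * (x - y) * (x - y) \<le> (exp x - exp y) * (x - y)"
      using that(1) by (intro mult_right_mono) auto
    then show ?thesis by (simp add: power2_eq_square mult.assoc)
  qed
  show ?thesis
    using *[of y x] *[of x y] assms
    by (cases "y \<le> x") (auto simp: power2_commute algebra_simps)
qed

lemma exp_diff_le_of_nonpos:
  fixes x y :: real
  assumes "x \<le> 0" "y \<le> 0"
  shows "\<bar>exp x - exp y\<bar> \<le> \<bar>x - y\<bar>"
proof -
  have *: "exp x - exp y \<le> x - y" if "y \<le> x" "x \<le> 0" for x y :: real
  proof -
    have "exp x - exp y = exp x * (1 - exp (y - x))"
      by (simp add: algebra_simps flip: exp_add)
    also have "\<dots> \<le> exp x * (x - y)"
    proof (rule mult_left_mono)
      show "1 - exp (y - x) \<le> x - y" using exp_ge_add_one_self[of "y - x"] by linarith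
    qed simp
    also have "\<dots> \<le> 1 * (x - y)"
      using that by (intro mult_right_mono) auto
    finally show ?thesis by simp
  qed
  show ?thesis
    using *[of y x] *[of x y] assms by (cases "y \<le> x") (auto simp: abs_if)
qed

text \<open>Tilting by \<open>exp S\<close> pushes the mean of \<open>S\<close> upwards by an amount controlled from below by its variance: with
  \<open>s\<close> the mean, \<open>exp (S x)\<close> may be replaced by \<open>exp (S x) - exp s\<close> on the right-hand side, and then the
  inequality holds pointwise by strong monotonicity.\<close>

lemma (in prob_space) variance_le_exponential_tilt:
  fixes S :: "'a \<Rightarrow> real"
  assumes S[measurable]: "S \<in> borel_measurable M" and bdd: "AE x in M. - L \<le> S x \<and> S x \<le> 0"
  shows "exp (- L) * (\<integral>x. (S x - expectation S)\<^sup>2 \<partial>M) \<le> (\<integral>x. exp (S x) * (S x - expectation S) \<partial>M)"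
proof -
  define s where "s = expectation S"
  have intS: "integrable M S"
    by (rule integrable_const_bound[of _ "L"]) (use bdd in auto)
  have s: "- L \<le> s"
    unfolding s_def by (rule integral_ge_const[OF intS]) (use bdd in auto)
  have b1: "AE x in M. \<bar>S x - s\<bar> \<le> L + \<bar>s\<bar>"
    using bdd by eventually_elim auto
  have i1: "integrable M (\<lambda>x. (S x - s)\<^sup>2)"
  proof (rule integrable_const_bound[of _ "(L + \<bar>s\<bar>)\<^sup>2"])
    show "AE x in M. norm ((S x - s)\<^sup>2) \<le> (L + \<bar>s\<bar>)\<^sup>2"
      using b1 by eventually_elim (auto intro: abs_le_square_iff[THEN iffD1])
  qed simp
  have i2: "integrable M (\<lambda>x. exp (S x) * (S x - s))"
  proof (rule integrable_const_bound[of _ "L + \<bar>s\<bar>"])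
    show "AE x in M. norm (exp (S x) * (S x - s)) \<le> L + \<bar>s\<bar>"
      using b1 bdd
    proof eventually_elim
      case (elim x)
      have "exp (S x) * \<bar>S x - s\<bar> \<le> 1 * \<bar>S x - s\<bar>"
        using elim by (intro mult_right_mono) auto
      then show ?case using elim by (simp add: abs_mult)
    qed
  qed simp
  have i3: "integrable M (\<lambda>x. exp s * (S x - s))" using intS by simp
  have "exp (- L) * (\<integral>x. (S x - s)\<^sup>2 \<partial>M) = (\<integral>x. exp (- L) * (S x - s)\<^sup>2 \<partial>M)"
    by simp
  also have "\<dots> \<le> (\<integral>x. exp (S x) * (S x - s) - exp s * (S x - s) \<partial>M)"
  proof (rule integral_mono_AE)
    show "AE x in M. exp (- L) * (S x - s)\<^sup>2 \<le> exp (S x) * (S x - s) - exp s * (S x - s)"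
      using bdd
    proof eventually_elim
      case (elim x)
      then show ?case using exp_strong_monotone[of L "S x" s] s by (simp add: algebra_simps)
    qed
  qed (use i1 i2 i3 in auto)
  also have "\<dots> = (\<integral>x. exp (S x) * (S x - s) \<partial>M) - (\<integral>x. exp s * (S x - s) \<partial>M)"
    by (rule Bochner_Integration.integral_diff[OF i2 i3])
  also have "(\<integral>x. exp s * (S x - s) \<partial>M) = 0"
    using intS by (simp add: s_def prob_space)
  finally show ?thesis by (simp add: s_def)
qed

lemma (in prob_space) square_L1_le_square_L2:
  fixes f :: "'a \<Rightarrow> real"
  assumes "integrable M f" "integrable M (\<lambda>x. (f x)\<^sup>2)"
  shows "(L1_norm M f)\<^sup>2 \<le> (L2_norm M f)\<^sup>2"
proof -
  have "0 \<le> variance (\<lambda>x. \<bar>f x\<bar>)" by simp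
  also have "\<dots> = (\<integral>x. (f x)\<^sup>2 \<partial>M) - (expectation (\<lambda>x. \<bar>f x\<bar>))\<^sup>2"
    using assms by (subst variance_eq) auto
  finally show ?thesis by (simp add: L1_norm_def L2_norm_def)
qed

section \<open>The variance of the logarithm\<close>

text \<open>In the names below, the weight of \<open>X\<close> is the product of \<open>W (X\<^sub>f)\<close> over the edges; normalized, it is the
  density of the law of \<open>X\<close> tilted towards copies of the hypergraph.\<close>

locale bounded_hypergraphon_system =
  fixes k :: nat and V :: "'v set" and E :: "'v set set"
    and \<eta> :: "'v set \<Rightarrow> nat \<Rightarrow> 'v"
    and W :: "(nat set \<Rightarrow> real) \<Rightarrow> real" and a M :: real
  assumes H: "uniform_hypergraph k V E" and orderings: "edge_orderings k E \<eta>"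
    and W: "hypergraphon k W"
    and a_pos: "0 < a" and a_le_1: "a \<le> 1"
    and W_bounds: "AE x in cube (index_sets k). a \<le> W x \<and> W x \<le> 1"
    and M_eq: "M = ln (1 / a)"
begin

abbreviation "\<mu> \<equiv> cube (index_sets k)"
abbreviation "\<nu> \<equiv> cube (vertex_sets k V)"

sublocale \<mu>: prob_space \<mu> by (rule prob_space_cube)
sublocale \<nu>: prob_space \<nu> by (rule prob_space_cube)

definition "mean_log = (\<integral>x. ln (W x) \<partial>\<mu>)"
definition "centered_log x = ln (W x) - mean_log"
definition "edge_weight X = (\<Prod>f\<in>E. W (edge_point k \<eta> f X))"
definition "log_weight X = (\<Sum>f\<in>E. ln (W (edge_point k \<eta> f X)))"

lemma finite_E: "finite E"
proof (rule finite_subset)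
  show "E \<subseteq> Pow V" "finite (Pow V)" using H by (auto simp: uniform_hypergraph_def)
qed

lemma edge_point_measure_preserving:
  assumes "e \<in> E" shows "measure_preserving \<nu> \<mu> (edge_point k \<eta> e)"
  unfolding edge_point_def
  using measure_preserving_edge[of "\<eta> e" k e V] H orderings assms
  by (auto simp: uniform_hypergraph_def edge_orderings_def)

lemma M_nonneg: "0 \<le> M"
  using a_pos a_le_1 by (simp add: M_eq)

lemma log_bounds: "AE x in \<mu>. - M \<le> ln (W x) \<and> ln (W x) \<le> 0"
  using W_bounds
proof eventually_elim
  case (elim x)
  then have "ln a \<le> ln (W x)" using a_pos by simp
  then show ?case using elim a_pos by (simp add: M_eq ln_div)
qed

lemma W_measurable [measurable]: "W \<in> borel_measurable \<mu>"
  using W by (simp add: hypergraphon_def)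

lemma log_integrable: "integrable \<mu> (\<lambda>x. ln (W x))"
  by (rule bounded_integrable_cube[of _ _ M]) (use log_bounds in auto)

lemma mean_log_bounds: "- M \<le> mean_log" "mean_log \<le> 0"
  unfolding mean_log_def using log_bounds
  by (auto intro!: \<mu>.integral_ge_const \<mu>.integral_le_const log_integrable)

lemma centered_log_measurable [measurable]: "centered_log \<in> borel_measurable \<mu>"
  unfolding centered_log_def by measurable

lemma centered_log_bound: "AE x in \<mu>. \<bar>centered_log x\<bar> \<le> M"
  using log_bounds mean_log_bounds by (auto simp: centered_log_def)

lemma centered_log_mean_zero: "(\<integral>x. centered_log x \<partial>\<mu>) = 0"
  using log_integrable by (simp add: centered_log_def mean_log_def \<mu>.prob_space)

lemma centered_log_symmetric: "\<pi> permutes {1..k} \<Longrightarrow> AE x in \<mu>. centered_log (perm_act k \<pi> x) = centered_log x"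
  using W by (auto simp: hypergraphon_def centered_log_def)

lemma centered_log_square_integrable: "integrable \<mu> (\<lambda>x. (centered_log x)\<^sup>2)"
  by (rule bounded_integrable_cube[of _ _ "M\<^sup>2"])
    (use centered_log_bound in \<open>auto elim!: eventually_mono simp: abs_le_square_iff[symmetric]\<close>)

lemma edge_measurable:
  "e \<in> E \<Longrightarrow> h \<in> borel_measurable \<mu> \<Longrightarrow> (\<lambda>X. h (edge_point k \<eta> e X)) \<in> borel_measurable \<nu>"
  by (rule measurable_compose[OF measure_preservingD(1)[OF edge_point_measure_preserving]])

lemma log_weight_measurable [measurable]: "log_weight \<in> borel_measurable \<nu>"
  unfolding log_weight_def by (intro borel_measurable_sum edge_measurable) auto

lemma edge_weight_measurable [measurable]: "edge_weight \<in> borel_measurable \<nu>"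
  unfolding edge_weight_def by (intro borel_measurable_prod edge_measurable) auto

lemma edge_weight_eq_exp_log_weight: "AE X in \<nu>. edge_weight X = exp (log_weight X) \<and> - (real (card E) * M) \<le> log_weight X \<and> log_weight X \<le> 0"
proof -
  have "AE X in \<nu>. \<forall>f\<in>E. a \<le> W (edge_point k \<eta> f X)"
    using W_bounds finite_E
    by (intro AE_finite_allI measure_preserving_AE[OF edge_point_measure_preserving]) auto
  moreover have "AE X in \<nu>. \<forall>f\<in>E. - M \<le> ln (W (edge_point k \<eta> f X)) \<and> ln (W (edge_point k \<eta> f X)) \<le> 0"
    using log_bounds finite_E
    by (intro AE_finite_allI measure_preserving_AE[OF edge_point_measure_preserving]) auto
  ultimately show ?thesis
  proof eventually_elim
    case (elim X)
    have "exp (log_weight X) = (\<Prod>f\<in>E. exp (ln (W (edge_point k \<eta> f X))))"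
      by (simp add: log_weight_def exp_sum finite_E)
    also have "\<dots> = edge_weight X"
      unfolding edge_weight_def using elim(1) a_pos by (intro prod.cong) force+
    finally have "edge_weight X = exp (log_weight X)" ..
    moreover have "- (real (card E) * M) = (\<Sum>f\<in>E. - M)" by simp
    moreover have "(\<Sum>f\<in>E. - M) \<le> log_weight X" unfolding log_weight_def using elim(2) by (intro sum_mono) auto
    moreover have "log_weight X \<le> 0" unfolding log_weight_def using elim(2) by (intro sum_nonpos) auto
    ultimately show ?case by simp
  qed
qed

lemma edge_weight_bounds: "AE X in \<nu>. 0 \<le> edge_weight X \<and> edge_weight X \<le> 1 \<and> exp (- (real (card E) * M)) \<le> edge_weight X"
  using edge_weight_eq_exp_log_weight by eventually_elim auto

lemma edge_weight_integrable: "integrable \<nu> edge_weight"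
  by (rule bounded_integrable_cube[of _ _ 1]) (use edge_weight_bounds in auto)

lemma hom_density_eq: "hom_density k V E \<eta> W = (\<integral>X. edge_weight X \<partial>\<nu>)"
  by (simp add: hom_density_def edge_weight_def)

lemma hom_density_bounds: "0 < hom_density k V E \<eta> W" "hom_density k V E \<eta> W \<le> 1"
proof -
  have "exp (- (real (card E) * M)) \<le> (\<integral>X. edge_weight X \<partial>\<nu>)"
    using edge_weight_bounds by (intro \<nu>.integral_ge_const edge_weight_integrable) auto
  then show "0 < hom_density k V E \<eta> W"
    unfolding hom_density_eq by (rule less_le_trans[rotated]) simp
  show "hom_density k V E \<eta> W \<le> 1"
    unfolding hom_density_eq using edge_weight_bounds by (intro \<nu>.integral_le_const edge_weight_integrable) auto
qed

lemma log_weight_mean: "(\<integral>X. log_weight X \<partial>\<nu>) = real (card E) * mean_log"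
proof -
  have "(\<integral>X. log_weight X \<partial>\<nu>) = (\<Sum>f\<in>E. \<integral>X. ln (W (edge_point k \<eta> f X)) \<partial>\<nu>)"
    unfolding log_weight_def
    by (intro Bochner_Integration.integral_sum measure_preserving_integrable[OF edge_point_measure_preserving]
        log_integrable)
  also have "\<dots> = (\<Sum>f\<in>E. mean_log)"
    unfolding mean_log_def
    by (intro sum.cong refl measure_preserving_integral[OF edge_point_measure_preserving]) auto
  finally show ?thesis by simp
qed

lemma log_weight_centered: "log_weight X - real (card E) * mean_log = (\<Sum>f\<in>E. centered_log (edge_point k \<eta> f X))"
  by (simp add: log_weight_def centered_log_def sum_subtractf)

lemma centered_log_edge_product_integrable:
  assumes "e \<in> E" "f \<in> E"
  shows "integrable \<nu> (\<lambda>X. centered_log (edge_point k \<eta> e X) * centered_log (edge_point k \<eta> f X))"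
proof (rule bounded_integrable_cube)
  show "AE X in \<nu>. \<bar>centered_log (edge_point k \<eta> e X) * centered_log (edge_point k \<eta> f X)\<bar> \<le> M * M"
    using measure_preserving_AE[OF edge_point_measure_preserving[OF assms(1)] centered_log_bound]
      measure_preserving_AE[OF edge_point_measure_preserving[OF assms(2)] centered_log_bound]
    by eventually_elim (auto simp: abs_mult M_nonneg intro!: mult_mono)
qed (use assms in \<open>auto intro!: borel_measurable_times edge_measurable\<close>)

text \<open>Expanding the square, the diagonal terms contribute \<open>card E\<close> times the variance of \<open>ln W\<close>, and the
  off-diagonal covariances are nonnegative.\<close>

lemma variance_log_weight_lower_bound:
  "real (card E) * (\<integral>x. (centered_log x)\<^sup>2 \<partial>\<mu>) \<le> (\<integral>X. (log_weight X - real (card E) * mean_log)\<^sup>2 \<partial>\<nu>)"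
proof -
  let ?c = "\<lambda>e f. \<integral>X. centered_log (edge_point k \<eta> e X) * centered_log (edge_point k \<eta> f X) \<partial>\<nu>"
  have diag: "?c e e = (\<integral>x. (centered_log x)\<^sup>2 \<partial>\<mu>)" if "e \<in> E" for e
    using measure_preserving_integral[OF edge_point_measure_preserving[OF that], of "\<lambda>x. (centered_log x)\<^sup>2"]
    by (simp add: power2_eq_square)
  have "real (card E) * (\<integral>x. (centered_log x)\<^sup>2 \<partial>\<mu>) = (\<Sum>e\<in>E. ?c e e)"
    by (simp add: diag)
  also have "\<dots> \<le> (\<Sum>e\<in>E. \<Sum>f\<in>E. ?c e f)"
    by (intro sum_mono member_le_sum finite_E)
      (auto intro!: edge_covariance_nonneg[OF centered_log_measurable centered_log_bound centered_log_symmetric H orderings])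
  also have "\<dots> = (\<integral>X. (\<Sum>e\<in>E. \<Sum>f\<in>E. centered_log (edge_point k \<eta> e X) * centered_log (edge_point k \<eta> f X)) \<partial>\<nu>)"
    by (simp add: centered_log_edge_product_integrable)
  also have "\<dots> = (\<integral>X. (log_weight X - real (card E) * mean_log)\<^sup>2 \<partial>\<nu>)"
    by (simp add: log_weight_centered power2_eq_square sum_product)
  finally show ?thesis .
qed

lemma tilted_centered_log_integrable:
  assumes "e \<in> E"
  shows "integrable \<nu> (\<lambda>X. edge_weight X * centered_log (edge_point k \<eta> e X))"
proof (rule bounded_integrable_cube)
  show "AE X in \<nu>. \<bar>edge_weight X * centered_log (edge_point k \<eta> e X)\<bar> \<le> 1 * M"
    using measure_preserving_AE[OF edge_point_measure_preserving[OF assms] centered_log_bound] edge_weight_bounds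
    by eventually_elim (simp only: abs_mult, intro mult_mono, auto)
qed (use assms in \<open>auto intro!: borel_measurable_times edge_measurable\<close>)

text \<open>Since the centered logarithm has mean zero, its tilted mean sees only the deviation of the rooted
  density from the constant \<open>1\<close>.\<close>

lemma tilted_edge_mean_le:
  assumes e: "e \<in> E"
  shows "(\<integral>X. edge_weight X * centered_log (edge_point k \<eta> e X) \<partial>\<nu>)
      \<le> M * L1_norm \<mu> (\<lambda>x. normalized_rooted_density k V E \<eta> W e x - 1)"
proof -
  define t where "t = hom_density k V E \<eta> W"
  define r where "r = rooted_density k V E \<eta> W e"
  define q where "q = normalized_rooted_density k V E \<eta> W e"
  have t: "0 < t" "t \<le> 1" using hom_density_bounds by (simp_all add: t_def)
  have rq: "r x = t * q x" for x
    using t by (simp add: r_def q_def t_def normalized_rooted_density_def)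
  have uint: "integrable \<mu> centered_log" by (rule bounded_integrable_cube[OF centered_log_measurable centered_log_bound])
  note Pu = tilted_centered_log_integrable[OF e]
  note Pu' = Pu[unfolded edge_weight_def]
  have ru: "integrable \<mu> (\<lambda>x. r x * centered_log x)"
    "(\<integral>x. r x * centered_log x \<partial>\<mu>) = (\<integral>X. edge_weight X * centered_log (edge_point k \<eta> e X) \<partial>\<nu>)"
    using rooted_density_weighted[OF H orderings e, where w = centered_log, OF Pu'] by (simp_all add: r_def edge_weight_def)
  have "integrable \<mu> r"
    using rooted_density_weighted(1)[OF H orderings e, where w = "\<lambda>_. 1" and W = W]
      edge_weight_integrable[unfolded edge_weight_def[abs_def]]
    by (simp add: r_def)
  then have "integrable \<mu> (\<lambda>x. r x / t)" by simp
  moreover have "(\<lambda>x. r x / t) = q" using t by (simp add: rq)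
  ultimately have qint: "integrable \<mu> q" by simp
  have "integrable \<mu> (\<lambda>x. (r x * centered_log x) / t)" using ru(1) by simp
  moreover have "(\<lambda>x. (r x * centered_log x) / t) = (\<lambda>x. q x * centered_log x)" using t by (simp add: rq)
  ultimately have quint: "integrable \<mu> (\<lambda>x. q x * centered_log x)" by simp
  have absint: "integrable \<mu> (\<lambda>x. \<bar>q x - 1\<bar>)" using qint by simp
  have L1: "L1_norm \<mu> (\<lambda>x. q x - 1) = (\<integral>x. \<bar>q x - 1\<bar> \<partial>\<mu>)" by (simp add: L1_norm_def)
  have "(\<integral>X. edge_weight X * centered_log (edge_point k \<eta> e X) \<partial>\<nu>) = t * (\<integral>x. q x * centered_log x \<partial>\<mu>)"
    by (simp add: ru(2)[symmetric] rq mult.assoc)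
  also have "(\<integral>x. q x * centered_log x \<partial>\<mu>) = (\<integral>x. q x * centered_log x - centered_log x \<partial>\<mu>)"
    using quint uint by (simp add: centered_log_mean_zero)
  also have "t * \<dots> \<le> t * (\<integral>x. M * \<bar>q x - 1\<bar> \<partial>\<mu>)"
  proof (intro mult_left_mono integral_mono_AE)
    show "AE x in \<mu>. q x * centered_log x - centered_log x \<le> M * \<bar>q x - 1\<bar>"
      using centered_log_bound
    proof eventually_elim
      case (elim x)
      have "q x * centered_log x - centered_log x = (q x - 1) * centered_log x" by (simp add: algebra_simps)
      also have "\<dots> \<le> \<bar>q x - 1\<bar> * \<bar>centered_log x\<bar>" by (metis abs_ge_self abs_mult)
      also have "\<dots> \<le> \<bar>q x - 1\<bar> * M" using elim by (intro mult_left_mono) auto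
      finally show ?case by (simp add: mult.commute)
    qed
  qed (use quint uint absint t in auto)
  also have "\<dots> = t * (M * L1_norm \<mu> (\<lambda>x. q x - 1))" by (simp add: L1)
  also have "\<dots> \<le> 1 * (M * L1_norm \<mu> (\<lambda>x. q x - 1))"
    using t M_nonneg by (intro mult_right_mono) (auto simp: L1)
  finally show ?thesis by (simp add: q_def)
qed

lemma tilted_log_weight_le:
  "(\<integral>X. edge_weight X * (log_weight X - real (card E) * mean_log) \<partial>\<nu>) \<le> M * rooted_deviation k V E \<eta> W"
proof -
  have "(\<integral>X. edge_weight X * (log_weight X - real (card E) * mean_log) \<partial>\<nu>)
      = (\<Sum>e\<in>E. \<integral>X. edge_weight X * centered_log (edge_point k \<eta> e X) \<partial>\<nu>)"
    by (simp add: log_weight_centered sum_distrib_left tilted_centered_log_integrable)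
  also have "\<dots> \<le> (\<Sum>e\<in>E. M * L1_norm \<mu> (\<lambda>x. normalized_rooted_density k V E \<eta> W e x - 1))"
    by (intro sum_mono tilted_edge_mean_le)
  finally show ?thesis by (simp add: rooted_deviation_def sum_distrib_left)
qed

text \<open>Both sides are compared with the variance of the total logarithmic weight: it is bounded below through the
  covariances and above through the shift of its mean under the tilt.\<close>

lemma log_variance_bound:
  "real (card E) * (\<integral>x. (centered_log x)\<^sup>2 \<partial>\<mu>)
    \<le> exp (real (card E) * M) * M * rooted_deviation k V E \<eta> W"
proof -
  let ?L = "real (card E) * M" and ?s = "real (card E) * mean_log"
  have "exp (- ?L) * (\<integral>X. (log_weight X - ?s)\<^sup>2 \<partial>\<nu>) \<le> (\<integral>X. exp (log_weight X) * (log_weight X - ?s) \<partial>\<nu>)"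
    using \<nu>.variance_le_exponential_tilt[OF log_weight_measurable, of ?L] edge_weight_eq_exp_log_weight
    by (auto simp: log_weight_mean elim: eventually_mono)
  also have "\<dots> = (\<integral>X. edge_weight X * (log_weight X - ?s) \<partial>\<nu>)"
    by (rule integral_cong_AE) (use edge_weight_eq_exp_log_weight in auto)
  also have "\<dots> \<le> M * rooted_deviation k V E \<eta> W" by (rule tilted_log_weight_le)
  finally have "exp ?L * (exp (- ?L) * (\<integral>X. (log_weight X - ?s)\<^sup>2 \<partial>\<nu>)) \<le> exp ?L * (M * rooted_deviation k V E \<eta> W)"
    by (intro mult_left_mono) auto
  then have "(\<integral>X. (log_weight X - ?s)\<^sup>2 \<partial>\<nu>) \<le> exp ?L * M * rooted_deviation k V E \<eta> W"
    by (simp add: mult.assoc[symmetric] flip: exp_add)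
  with variance_log_weight_lower_bound show ?thesis by linarith
qed

lemma rooted_deviation_nonneg: "0 \<le> rooted_deviation k V E \<eta> W"
  by (auto simp: rooted_deviation_def L1_norm_def intro!: sum_nonneg)

text \<open>The exponential is \<open>1\<close>-Lipschitz on the nonpositive half-line, where \<open>ln W\<close> and its mean live; the
  \<open>L\<^sup>1\<close> norm is dominated by the \<open>L\<^sup>2\<close> norm on a probability space.\<close>

lemma deviation_from_constant_le:
  "(L2_norm \<mu> (\<lambda>x. W x - exp mean_log))\<^sup>2 \<le> (\<integral>x. (centered_log x)\<^sup>2 \<partial>\<mu>)"
  "(L1_norm \<mu> (\<lambda>x. W x - exp mean_log))\<^sup>2 \<le> (\<integral>x. (centered_log x)\<^sup>2 \<partial>\<mu>)"
proof -
  let ?f = "\<lambda>x. W x - exp mean_log"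
  have le: "AE x in \<mu>. \<bar>?f x\<bar> \<le> \<bar>centered_log x\<bar>"
    using W_bounds log_bounds
  proof eventually_elim
    case (elim x)
    then have "exp (ln (W x)) = W x" using a_pos by simp
    then show ?case
      using exp_diff_le_of_nonpos[of "ln (W x)" mean_log] elim mean_log_bounds(2) by (simp add: centered_log_def)
  qed
  then have sq: "AE x in \<mu>. (?f x)\<^sup>2 \<le> (centered_log x)\<^sup>2"
    by eventually_elim (simp add: abs_le_square_iff)
  have int: "integrable \<mu> ?f"
    by (rule bounded_integrable_cube[of _ _ M]) (use le centered_log_bound in auto)
  have int2: "integrable \<mu> (\<lambda>x. (?f x)\<^sup>2)"
    by (rule Bochner_Integration.integrable_bound[OF centered_log_square_integrable]) (use sq in auto)
  have "(L2_norm \<mu> ?f)\<^sup>2 = (\<integral>x. (?f x)\<^sup>2 \<partial>\<mu>)" by (simp add: L2_norm_def)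
  also have "\<dots> \<le> (\<integral>x. (centered_log x)\<^sup>2 \<partial>\<mu>)"
    by (rule integral_mono_AE[OF int2 centered_log_square_integrable sq])
  finally show L2: "(L2_norm \<mu> ?f)\<^sup>2 \<le> (\<integral>x. (centered_log x)\<^sup>2 \<partial>\<mu>)" .
  show "(L1_norm \<mu> ?f)\<^sup>2 \<le> (\<integral>x. (centered_log x)\<^sup>2 \<partial>\<mu>)"
    using \<mu>.square_L1_le_square_L2[OF int int2] L2 by linarith
qed

end

theorem theorem4p5:
  fixes k m :: nat and V :: "'v set" and E :: "'v set set"
    and \<eta> :: "'v set \<Rightarrow> nat \<Rightarrow> 'v"
    and W :: "(nat set \<Rightarrow> real) \<Rightarrow> real" and a M p :: real
  assumes "k \<ge> 2"
    and "uniform_hypergraph k V E"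
    and "m = card E" and "m \<ge> 1"
    and "edge_orderings k E \<eta>"
    and "hypergraphon k W"
    and "0 < a" and "a \<le> 1"
    and "AE x in cube (index_sets k). a \<le> W x \<and> W x \<le> 1"
    and "M = ln (1 / a)"
    and "p = exp (\<integral>x. ln (W x) \<partial>cube (index_sets k))"
  shows "(L2_norm (cube (index_sets k))
            (\<lambda>x. ln (W x) - (\<integral>y. ln (W y) \<partial>cube (index_sets k))))\<^sup>2
           \<le> 1 / real m * (2 * exp (real m * M) + (real m)\<^sup>2 * M\<^sup>2) * M * rooted_deviation k V E \<eta> W
       \<and> max ((L2_norm (cube (index_sets k)) (\<lambda>x. W x - p))\<^sup>2)
             ((L1_norm (cube (index_sets k)) (\<lambda>x. W x - p))\<^sup>2)
           \<le> 1 / real m * (2 * exp (real m * M) + (real m)\<^sup>2 * M\<^sup>2) * M * rooted_deviation k V E \<eta> W"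
proof -
  interpret bounded_hypergraphon_system k V E \<eta> W a M
    by unfold_locales (use assms in auto)
  let ?\<Delta> = "rooted_deviation k V E \<eta> W" and ?v = "\<integral>x. (centered_log x)\<^sup>2 \<partial>\<mu>"
  have "real m * ?v \<le> exp (real m * M) * (M * ?\<Delta>)"
    using log_variance_bound assms(3) by (simp add: mult.assoc)
  also have "\<dots> \<le> (2 * exp (real m * M) + (real m)\<^sup>2 * M\<^sup>2) * (M * ?\<Delta>)"
    by (rule mult_right_mono) (use M_nonneg rooted_deviation_nonneg in auto)
  finally have v: "?v \<le> 1 / real m * (2 * exp (real m * M) + (real m)\<^sup>2 * M\<^sup>2) * M * ?\<Delta>"
    using assms(4) by (simp add: field_simps)
  have "(L2_norm \<mu> (\<lambda>x. ln (W x) - (\<integral>y. ln (W y) \<partial>\<mu>)))\<^sup>2 = ?v"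
    by (simp add: L2_norm_def centered_log_def mean_log_def)
  moreover have "p = exp mean_log" by (simp add: assms(11) mean_log_def)
  ultimately show ?thesis
    using v deviation_from_constant_le by (auto intro: order_trans)
qed

end
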